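(* Let $\mathcal{M}_1,\mathcal{M}_2\subseteq\Theta$ be distinct models that overlap at a point $\theta\in\mathcal{M}_1\cap\mathcal{M}_2$ on their relative interiors. Then there is no parameterization with respect to which both these models are convex in a neighbourhood of $\theta$. That is, there is no reparameterization $\varphi$ of $\Theta$ and neighbourhood $U$ of $\varphi(\theta)$ such that $\varphi(\mathcal{M}_1)\cap U$ and $\varphi(\mathcal{M}_2)\cap U$ are both convex sets having $\varphi(\theta)$ in their relative interiors.
   Context: $\Theta$ is an open subset of $\mathbb{R}^k$; models are subsets of $\Theta$ that are either differentiable manifolds or semialgebraic sets. A reparameterization $\varphi$ is a twice differentiable bijection from $\Theta$ onto an open subset of $\mathbb{R}^k$ with invertible Jacobian. The relative interior of a convex set is its interior relative to its affine hull. The tangent cone $C_\theta(\mathcal{M})$ of $\mathcal{M}$ at $\theta\in\mathcal{M}$ is the set of limits of sequences $\alpha_n(\theta_n-\theta)$ with $\alpha_n>0$, $\theta_n\in\mathcal{M}$, $\theta_n\to\theta$. $\mathcal{M}_1$ and $\mathcal{M}_2$ overlap at $\theta\in\mathcal{M}_1\cap\mathcal{M}_2$ if there exists $h\in C_\theta(\mathcal{M}_1)\cap C_\theta(\mathcal{M}_2)$ with $h\notin C_\theta(\mathcal{M}_1\cap\mathcal{M}_2)$. *)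

theory Defs
  imports "HOL-Analysis.Analysis"
begin

section \<open>Differentiable manifolds in Euclidean space\<close>

definition C1_on :: "(real^'k) set \<Rightarrow> (real^'k \<Rightarrow> real^'k) \<Rightarrow> bool" where
  "C1_on U f \<longleftrightarrow> f differentiable_on U \<and> continuous_on U (\<lambda>x. jacobian f (at x))"

definition C1_diffeomorphism ::
    "(real^'k) set \<Rightarrow> (real^'k) set \<Rightarrow> (real^'k \<Rightarrow> real^'k) \<Rightarrow> bool" where
  "C1_diffeomorphism U V \<psi> \<longleftrightarrow>
     open U \<and> open V \<and> bij_betw \<psi> U V \<and> C1_on U \<psi> \<and> C1_on V (inv_into U \<psi>)"

text \<open>
  Embedded submanifolds (without boundary) of \<open>\<real>\<^sup>k\<close>, of class \<open>C\<^sup>1\<close> and of some constant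
  dimension \<open>d\<close>. As \<open>C\<^sup>1\<close> is the lowest smoothness class, all smoother submanifolds are included.
\<close>

definition differentiable_manifold :: "(real^'k) set \<Rightarrow> bool" where
  "differentiable_manifold M \<longleftrightarrow>
     (\<exists>d. \<forall>x\<in>M. \<exists>U V \<psi> S. x \<in> U \<and> C1_diffeomorphism U V \<psi> \<and>
        subspace S \<and> dim S = d \<and> \<psi> ` (U \<inter> M) = V \<inter> S)"

section \<open>Semialgebraic sets\<close>

text \<open>
  On \<open>real^'k\<close>, the functions satisfying \<open>real_polynomial_function\<close> are exactly those given by
  polynomials in the \<open>k\<close> coordinates with real coefficients.
\<close>

definition basic_semialgebraic :: "(real^'k) set \<Rightarrow> bool" where
  "basic_semialgebraic B \<longleftrightarrow>
     (\<exists>P Q. finite P \<and> finite Q \<and>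
        (\<forall>p\<in>P. real_polynomial_function p) \<and> (\<forall>q\<in>Q. real_polynomial_function q) \<and>
        B = {x. (\<forall>p\<in>P. p x = 0) \<and> (\<forall>q\<in>Q. q x > 0)})"

definition semialgebraic :: "(real^'k) set \<Rightarrow> bool" where
  "semialgebraic M \<longleftrightarrow>
     (\<exists>\<F>. finite \<F> \<and> (\<forall>B\<in>\<F>. basic_semialgebraic B) \<and> M = \<Union>\<F>)"

section \<open>Models, reparameterizations, tangent cones and overlap\<close>

definition model :: "(real^'k) set \<Rightarrow> (real^'k) set \<Rightarrow> bool" where
  "model \<Theta> M \<longleftrightarrow> M \<subseteq> \<Theta> \<and> (differentiable_manifold M \<or> semialgebraic M)"

text \<open>
  The second derivative is expressed as the derivative of the Jacobian matrix. Only the values of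
  \<open>\<phi>\<close> on the open set \<open>\<Theta>\<close> matter.
\<close>

definition reparameterization :: "(real^'k) set \<Rightarrow> (real^'k \<Rightarrow> real^'k) \<Rightarrow> bool" where
  "reparameterization \<Theta> \<phi> \<longleftrightarrow>
     inj_on \<phi> \<Theta> \<and> open (\<phi> ` \<Theta>) \<and>
     \<phi> differentiable_on \<Theta> \<and> (\<lambda>x. jacobian \<phi> (at x)) differentiable_on \<Theta> \<and>
     (\<forall>x\<in>\<Theta>. invertible (jacobian \<phi> (at x)))"

definition tangent_cone :: "'a::real_normed_vector \<Rightarrow> 'a set \<Rightarrow> 'a set" where
  "tangent_cone \<theta> M =
     {h. \<exists>(\<alpha> :: nat \<Rightarrow> real) t. (\<forall>n. \<alpha> n > 0) \<and> (\<forall>n. t n \<in> M) \<and> t \<longlonglongrightarrow> \<theta> \<and>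
           (\<lambda>n. \<alpha> n *\<^sub>R (t n - \<theta>)) \<longlonglongrightarrow> h}"

definition overlap_at :: "'a::real_normed_vector \<Rightarrow> 'a set \<Rightarrow> 'a set \<Rightarrow> bool" where
  "overlap_at \<theta> M\<^sub>1 M\<^sub>2 \<longleftrightarrow>
     \<theta> \<in> M\<^sub>1 \<inter> M\<^sub>2 \<and>
     (\<exists>h. h \<in> tangent_cone \<theta> M\<^sub>1 \<inter> tangent_cone \<theta> M\<^sub>2 \<and> h \<notin> tangent_cone \<theta> (M\<^sub>1 \<inter> M\<^sub>2))"

end

theory Submission
  imports Defs
begin

text \<open>
  Overlap is impossible between two sets that have the point in their relative interiors: near
  such a point a set coincides with its affine hull, which is closed, so every tangent direction
  \<open>h\<close> is realised by an actual segment starting at the point and lying in the set. A direction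
  tangent to both sets therefore gives a segment in both of them, which makes it tangent to the
  intersection (\<open>tangent_cone_Int_rel_interior\<close>).

  It remains to see that overlap does not depend on the parameterization. A map sends tangent
  vectors to tangent vectors through its derivative (\<open>tangent_cone_image\<close>). Applied to \<open>\<phi>\<close>, this
  carries a common tangent direction of the two models to their images, where it is
  tangent to the intersection of the images. Applied to the inverse of \<open>\<phi>\<close>, which is
  differentiable because it is continuous by invariance of domain, it carries the direction back to a
  tangent direction of the intersection of the models.
\<close>

lemma tangent_cone_mono: "M \<subseteq> N \<Longrightarrow> tangent_cone \<theta> M \<subseteq> tangent_cone \<theta> N"
  unfolding tangent_cone_def by blast

text \<open>
  Tangency depends only on the part of the set near the point: a sequence that converges to the
  point eventually enters every neighbourhood, so it can be started late enough to stay inside.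
\<close>

lemma tangent_cone_Int_neighbourhood:
  assumes "\<theta> \<in> interior U"
  shows "tangent_cone \<theta> (M \<inter> U) = tangent_cone \<theta> M"
proof
  show "tangent_cone \<theta> (M \<inter> U) \<subseteq> tangent_cone \<theta> M"
    by (rule tangent_cone_mono) blast
  show "tangent_cone \<theta> M \<subseteq> tangent_cone \<theta> (M \<inter> U)"
  proof
    fix h assume "h \<in> tangent_cone \<theta> M"
    then obtain \<alpha> :: "nat \<Rightarrow> real" and t where pos: "\<And>n. \<alpha> n > 0" and mem: "\<And>n. t n \<in> M"
      and t: "t \<longlonglongrightarrow> \<theta>" and lim: "(\<lambda>n. \<alpha> n *\<^sub>R (t n - \<theta>)) \<longlonglongrightarrow> h"
      unfolding tangent_cone_def by blast
    have "\<forall>\<^sub>F n in sequentially. t n \<in> interior U"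
      using topological_tendstoD[OF t open_interior assms] .
    then obtain k where k: "\<And>n. n \<ge> k \<Longrightarrow> t n \<in> interior U"
      unfolding eventually_sequentially by blast
    have "t (n + k) \<in> M \<inter> U" for n
      using mem k[of "n + k"] interior_subset by auto
    moreover have "(\<lambda>n. t (n + k)) \<longlonglongrightarrow> \<theta>"
      using LIMSEQ_ignore_initial_segment[OF t] .
    moreover have "(\<lambda>n. \<alpha> (n + k) *\<^sub>R (t (n + k) - \<theta>)) \<longlonglongrightarrow> h"
      using LIMSEQ_ignore_initial_segment[OF lim] .
    ultimately show "h \<in> tangent_cone \<theta> (M \<inter> U)"
      unfolding tangent_cone_def using pos
      by (intro CollectI exI[of _ "\<lambda>n. \<alpha> (n + k)"] exI[of _ "\<lambda>n. t (n + k)"]) simp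
  qed
qed

text \<open>
  The error of the linear approximation of \<open>f\<close> is \<open>o(\<parallel>t\<^sub>n - \<theta>\<parallel>)\<close>, and rescaling by \<open>\<alpha>\<^sub>n\<close> keeps it
  negligible because \<open>\<alpha>\<^sub>n \<parallel>t\<^sub>n - \<theta>\<parallel>\<close> converges to \<open>\<parallel>h\<parallel>\<close>.
\<close>

lemma tangent_cone_image:
  assumes f: "(f has_derivative D) (at \<theta>)" and h: "h \<in> tangent_cone \<theta> M"
  shows "D h \<in> tangent_cone (f \<theta>) (f ` M)"
proof -
  obtain \<alpha> :: "nat \<Rightarrow> real" and t where pos: "\<And>n. \<alpha> n > 0" and mem: "\<And>n. t n \<in> M"
    and t: "t \<longlonglongrightarrow> \<theta>" and lim: "(\<lambda>n. \<alpha> n *\<^sub>R (t n - \<theta>)) \<longlonglongrightarrow> h"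
    using h unfolding tangent_cone_def by blast
  interpret D: bounded_linear D
    using f by (rule has_derivative_bounded_linear)
  define r where "r y = f y - f \<theta> - D (y - \<theta>)" for y
  have "((\<lambda>y. norm (r y) / norm (y - \<theta>)) \<longlongrightarrow> 0) (at \<theta>)"
    using f unfolding has_derivative_iff_norm r_def by simp
  \<comment> \<open>Some \<open>t n\<close> may equal \<open>\<theta>\<close>; the quotient is \<open>0 / 0 = 0\<close> there, so the limit includes the point.\<close>
  then have "((\<lambda>y. norm (r y) / norm (y - \<theta>)) \<longlongrightarrow> 0) (nhds \<theta>)"
    using tendsto_at_iff_tendsto_nhds[of "\<lambda>y. norm (r y) / norm (y - \<theta>)" \<theta>] by simp
  then have "(\<lambda>n. norm (r (t n)) / norm (t n - \<theta>)) \<longlonglongrightarrow> 0"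
    using t by (rule filterlim_compose)
  then have "(\<lambda>n. norm (\<alpha> n *\<^sub>R (t n - \<theta>)) * (norm (r (t n)) / norm (t n - \<theta>)))
      \<longlonglongrightarrow> norm h * 0"
    by (intro tendsto_mult tendsto_norm lim)
  moreover have "norm (\<alpha> n *\<^sub>R (t n - \<theta>)) * (norm (r (t n)) / norm (t n - \<theta>))
      = norm (\<alpha> n *\<^sub>R r (t n))" for n
    by (cases "t n = \<theta>") (simp_all add: r_def D.zero)
  ultimately have "(\<lambda>n. \<alpha> n *\<^sub>R r (t n)) \<longlonglongrightarrow> 0"
    by (simp add: tendsto_norm_zero_iff del: norm_scaleR)
  then have "(\<lambda>n. D (\<alpha> n *\<^sub>R (t n - \<theta>)) + \<alpha> n *\<^sub>R r (t n)) \<longlonglongrightarrow> D h + 0"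
    by (intro tendsto_add D.tendsto lim)
  moreover have "D (\<alpha> n *\<^sub>R (t n - \<theta>)) + \<alpha> n *\<^sub>R r (t n) = \<alpha> n *\<^sub>R (f (t n) - f \<theta>)" for n
    unfolding r_def D.scaleR by (simp add: scaleR_diff_right)
  ultimately have "(\<lambda>n. \<alpha> n *\<^sub>R (f (t n) - f \<theta>)) \<longlonglongrightarrow> D h"
    by simp
  moreover have "(\<lambda>n. f (t n)) \<longlonglongrightarrow> f \<theta>"
    using has_derivative_continuous[OF f] t by (rule isCont_tendsto_compose)
  ultimately show ?thesis
    unfolding tangent_cone_def using pos mem
    by (intro CollectI exI[of _ \<alpha>] exI[of _ "\<lambda>n. f (t n)"]) simp
qed

text \<open>
  Each point \<open>\<theta> + \<alpha>\<^sub>n (t\<^sub>n - \<theta>)\<close> is an affine combination of two points of the set, and the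
  affine hull contains their limit because it is closed in finite dimension.
\<close>

lemma tangent_cone_subset_affine_hull:
  fixes N :: "'a::euclidean_space set"
  assumes "\<theta> \<in> N" "h \<in> tangent_cone \<theta> N"
  shows "\<theta> + h \<in> affine hull N"
proof -
  obtain \<alpha> :: "nat \<Rightarrow> real" and t where mem: "\<And>n. t n \<in> N"
    and lim: "(\<lambda>n. \<alpha> n *\<^sub>R (t n - \<theta>)) \<longlonglongrightarrow> h"
    using assms(2) unfolding tangent_cone_def by blast
  have "\<theta> + \<alpha> n *\<^sub>R (t n - \<theta>) \<in> affine hull N" for n
    using mem_affine[OF affine_affine_hull hull_inc[OF assms(1)] hull_inc[OF mem[of n]],
        of "1 - \<alpha> n" "\<alpha> n"]
    by (simp add: algebra_simps)
  moreover have "(\<lambda>n. \<theta> + \<alpha> n *\<^sub>R (t n - \<theta>)) \<longlonglongrightarrow> \<theta> + h"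
    by (intro tendsto_add tendsto_const lim)
  ultimately show ?thesis
    by (rule closed_sequentially[OF closed_affine_hull])
qed

text \<open>
  Near a point of its relative interior a set agrees with its affine hull, so a tangent direction
  is realised by a segment and not just by a sequence.
\<close>

lemma rel_interior_tangent_segment:
  fixes N :: "'a::euclidean_space set"
  assumes \<theta>: "\<theta> \<in> rel_interior N" and h: "h \<in> tangent_cone \<theta> N"
  shows "\<forall>\<^sub>F s in at_right 0. \<theta> + s *\<^sub>R h \<in> N"
proof -
  obtain e where "e > 0" and e: "ball \<theta> e \<inter> affine hull N \<subseteq> N" and "\<theta> \<in> N"
    using \<theta> unfolding mem_rel_interior_ball by blast
  have "((\<lambda>s. \<theta> + s *\<^sub>R h) \<longlongrightarrow> \<theta> + 0 *\<^sub>R h) (at_right 0)"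
    by (intro tendsto_intros)
  then have near: "\<forall>\<^sub>F s in at_right 0. \<theta> + s *\<^sub>R h \<in> ball \<theta> e"
    using \<open>e > 0\<close> by (intro topological_tendstoD) auto
  have "\<theta> + s *\<^sub>R h \<in> affine hull N" for s
    using mem_affine[OF affine_affine_hull hull_inc[OF \<open>\<theta> \<in> N\<close>]
        tangent_cone_subset_affine_hull[OF \<open>\<theta> \<in> N\<close> h], of "1 - s" s]
    by (simp add: algebra_simps)
  then have "\<theta> + s *\<^sub>R h \<in> N" if "\<theta> + s *\<^sub>R h \<in> ball \<theta> e" for s
    using e that by blast
  then show ?thesis
    by (rule eventually_mono[OF near])
qed

lemma tangent_cone_segment:
  assumes "\<forall>\<^sub>F s in at_right 0. \<theta> + s *\<^sub>R h \<in> N"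
  shows "h \<in> tangent_cone \<theta> N"
proof -
  obtain b where "b > 0" and b: "\<And>s. 0 < s \<Longrightarrow> s < b \<Longrightarrow> \<theta> + s *\<^sub>R h \<in> N"
    using assms unfolding eventually_at_right_field by auto
  define s where "s n = b / real (n + 2)" for n
  have pos: "0 < s n" and "s n < b" for n
    using \<open>b > 0\<close> by (simp_all add: s_def field_simps add_pos_nonneg)
  then have mem: "\<theta> + s n *\<^sub>R h \<in> N" for n
    using b by blast
  have "s \<longlonglongrightarrow> 0"
    unfolding s_def by (intro LIMSEQ_ignore_initial_segment[OF lim_const_over_n])
  then have "(\<lambda>n. \<theta> + s n *\<^sub>R h) \<longlonglongrightarrow> \<theta> + 0 *\<^sub>R h"
    by (intro tendsto_intros)
  moreover have "(\<lambda>n. inverse (s n) *\<^sub>R (\<theta> + s n *\<^sub>R h - \<theta>)) \<longlonglongrightarrow> h"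
    using pos by (simp add: less_imp_neq[symmetric])
  ultimately show ?thesis
    unfolding tangent_cone_def using pos mem
    by (intro CollectI exI[of _ "\<lambda>n. inverse (s n)"] exI[of _ "\<lambda>n. \<theta> + s n *\<^sub>R h"]) simp
qed

lemma tangent_cone_Int_rel_interior:
  fixes N\<^sub>1 N\<^sub>2 :: "'a::euclidean_space set"
  assumes "\<theta> \<in> rel_interior N\<^sub>1" "\<theta> \<in> rel_interior N\<^sub>2"
  shows "tangent_cone \<theta> N\<^sub>1 \<inter> tangent_cone \<theta> N\<^sub>2 \<subseteq> tangent_cone \<theta> (N\<^sub>1 \<inter> N\<^sub>2)"
proof
  fix h assume "h \<in> tangent_cone \<theta> N\<^sub>1 \<inter> tangent_cone \<theta> N\<^sub>2"
  then have "\<forall>\<^sub>F s in at_right 0. \<theta> + s *\<^sub>R h \<in> N\<^sub>1 \<inter> N\<^sub>2"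
    using assms by (auto intro: eventually_conj rel_interior_tangent_segment)
  then show "h \<in> tangent_cone \<theta> (N\<^sub>1 \<inter> N\<^sub>2)"
    by (rule tangent_cone_segment)
qed

text \<open>
  An inverse that is merely continuous is differentiable wherever the derivative of \<open>f\<close> is
  invertible, and continuity of the inverse comes for free from invariance of domain.
\<close>

lemma has_derivative_inv_into_invertible:
  fixes f :: "'a::euclidean_space \<Rightarrow> 'a"
  assumes "open S" "continuous_on S f" "inj_on f S" "x \<in> S"
    and f: "(f has_derivative D) (at x)" and g': "linear g'" "g' \<circ> D = id"
  shows "(inv_into S f has_derivative g') (at (f x))"
proof -
  obtain g where "homeomorphism S (f ` S) f g"
    using invariance_of_domain_homeomorphism[OF assms(1,2) order_refl assms(3)] .
  then have g: "continuous_on (f ` S) g" and gf: "\<And>z. z \<in> S \<Longrightarrow> g (f z) = z"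
    unfolding homeomorphism_def by blast+
  have "inv_into S f y = g y" if "y \<in> f ` S" for y
    using that by (auto simp: gf inv_into_f_f[OF assms(3)])
  then have "continuous_on (f ` S) (inv_into S f)"
    using continuous_on_cong[OF refl, of "f ` S" "inv_into S f" g] g by blast
  moreover have op: "open (f ` S)"
    using assms(2,1,3) by (rule invariance_of_domain)
  ultimately have cont: "isCont (inv_into S f) (f x)"
    using continuous_on_eq_continuous_at assms(4) by blast
  have inv: "inv_into S f (f x) = x"
    using assms(3,4) by (rule inv_into_f_f)
  show ?thesis
  proof (rule has_derivative_inverse_basic)
    show "(f has_derivative D) (at (inv_into S f (f x)))"
      using f unfolding inv .
    show "bounded_linear g'"
      using g'(1) by (simp add: linear_conv_bounded_linear)
    show "f x \<in> f ` S"
      using assms(4) by (rule imageI)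
    show "f (inv_into S f y) = y" if "y \<in> f ` S" for y
      using that by (rule f_inv_into_f)
  qed (fact g'(2) cont op)+
qed

theorem theorem2p12:
  fixes \<Theta> M\<^sub>1 M\<^sub>2 :: "(real^'k) set" and \<theta> :: "real^'k"
  assumes "open \<Theta>"
    and "model \<Theta> M\<^sub>1" and "model \<Theta> M\<^sub>2" and "M\<^sub>1 \<noteq> M\<^sub>2"
    and "overlap_at \<theta> M\<^sub>1 M\<^sub>2"
  shows "\<not> (\<exists>\<phi> U. reparameterization \<Theta> \<phi> \<and> \<phi> \<theta> \<in> interior U \<and>
            convex (\<phi> ` M\<^sub>1 \<inter> U) \<and> \<phi> \<theta> \<in> rel_interior (\<phi> ` M\<^sub>1 \<inter> U) \<and>
            convex (\<phi> ` M\<^sub>2 \<inter> U) \<and> \<phi> \<theta> \<in> rel_interior (\<phi> ` M\<^sub>2 \<inter> U))"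
proof (rule notI, elim exE conjE)
  fix \<phi> :: "real^'k \<Rightarrow> real^'k" and U
  assume rep: "reparameterization \<Theta> \<phi>" and U: "\<phi> \<theta> \<in> interior U"
    and ri: "\<phi> \<theta> \<in> rel_interior (\<phi> ` M\<^sub>1 \<inter> U)" "\<phi> \<theta> \<in> rel_interior (\<phi> ` M\<^sub>2 \<inter> U)"
  obtain h where \<theta>: "\<theta> \<in> M\<^sub>1 \<inter> M\<^sub>2" and h: "h \<in> tangent_cone \<theta> M\<^sub>1" "h \<in> tangent_cone \<theta> M\<^sub>2"
    and not_tangent: "h \<notin> tangent_cone \<theta> (M\<^sub>1 \<inter> M\<^sub>2)"
    using assms(5) unfolding overlap_at_def by blast
  have sub: "M\<^sub>1 \<subseteq> \<Theta>" "M\<^sub>2 \<subseteq> \<Theta>"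
    using assms(2,3) unfolding model_def by blast+
  then have "\<theta> \<in> \<Theta>"
    using \<theta> by blast
  have inj: "inj_on \<phi> \<Theta>" and diff: "\<phi> differentiable_on \<Theta>"
    and inv: "invertible (jacobian \<phi> (at \<theta>))"
    using rep \<open>\<theta> \<in> \<Theta>\<close> unfolding reparameterization_def by auto
  define J where "J = jacobian \<phi> (at \<theta>)"
  obtain K where K: "K ** J = mat 1"
    using inv unfolding J_def invertible_def by blast
  then have KJ: "K *v (J *v v) = v" for v
    by (simp add: matrix_vector_mul_assoc)
  have deriv: "(\<phi> has_derivative (*v) J) (at \<theta>)"
    using diff \<open>\<theta> \<in> \<Theta>\<close> \<open>open \<Theta>\<close> unfolding J_def
    by (metis differentiable_on_eq_differentiable_at jacobian_works)
  let ?\<psi> = "inv_into \<Theta> \<phi>"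
  have deriv_inv: "(?\<psi> has_derivative (*v) K) (at (\<phi> \<theta>))"
    using \<open>open \<Theta>\<close> differentiable_imp_continuous_on[OF diff] inj \<open>\<theta> \<in> \<Theta>\<close> deriv
    by (rule has_derivative_inv_into_invertible) (auto simp: KJ)

  have "J *v h \<in> tangent_cone (\<phi> \<theta>) (\<phi> ` M\<^sub>1 \<inter> U) \<inter> tangent_cone (\<phi> \<theta>) (\<phi> ` M\<^sub>2 \<inter> U)"
    using tangent_cone_image[OF deriv] h by (simp add: tangent_cone_Int_neighbourhood[OF U])
  then have "J *v h \<in> tangent_cone (\<phi> \<theta>) ((\<phi> ` M\<^sub>1 \<inter> U) \<inter> (\<phi> ` M\<^sub>2 \<inter> U))"
    using tangent_cone_Int_rel_interior[OF ri] by blast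
  moreover have "(\<phi> ` M\<^sub>1 \<inter> U) \<inter> (\<phi> ` M\<^sub>2 \<inter> U) \<subseteq> \<phi> ` (M\<^sub>1 \<inter> M\<^sub>2)"
    using inj_on_image_Int[OF inj sub] by blast
  ultimately have "J *v h \<in> tangent_cone (\<phi> \<theta>) (\<phi> ` (M\<^sub>1 \<inter> M\<^sub>2))"
    using tangent_cone_mono by blast
  from tangent_cone_image[OF deriv_inv this]
  have "h \<in> tangent_cone \<theta> (?\<psi> ` \<phi> ` (M\<^sub>1 \<inter> M\<^sub>2))"
    using \<open>\<theta> \<in> \<Theta>\<close> inj by (simp add: KJ)
  moreover have "?\<psi> ` \<phi> ` (M\<^sub>1 \<inter> M\<^sub>2) = M\<^sub>1 \<inter> M\<^sub>2"
    using inv_into_image_cancel[OF inj] sub by blast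
  ultimately show False
    using not_tangent by simp
qed

end
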